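(* For all integers $C\ge 2$, $\rho\ge 1$ and every $\epsilon>0$, there is an instance of \textsc{L-Sided Pricing} in which every $u\in L$ has capacity $C$ and every $v\in R$ has capacity $1$, whose locality gap with respect to the $\rho$-swap heuristic is at least $\frac{2C-1}{C}-\epsilon$.
   Context: An instance of \textsc{L-Sided Pricing} consists of a finite bipartite graph $G=(L\cup R,E)$ (each edge joins $L$ and $R$), a capacity $\mu_w\in\mathbb Z_{\ge 0}\cup\{\infty\}$ for every vertex $w$, and a budget $b_e\ge 0$ for every edge $e$. For $u\in L$ let $P_u=\{b_e: e\in E\text{ incident to }u\}$. A pricing is a function $p$ on $L$ with $p(u)\in P_u$ for every $u\in L$, extended by $p(v)=0$ for $v\in R$. For a pricing $p$, $\mathrm{val}(p)$ is the maximum of $\sum_{e=uv\in F}(p(u)+p(v))$ over all $F\subseteq E$ such that $p(u)+p(v)\le b_e$ for every $e=uv\in F$ and every vertex $w$ is incident to at most $\mu_w$ edges of $F$. Let $p^*$ be a pricing maximizing $\mathrm{val}$. For $\rho\ge1$, the locality gap of the instance with respect to the $\rho$-swap heuristic is the maximum of $\mathrm{val}(p^* )/\mathrm{val}(p)$ over all pricings $p$ such that $\mathrm{val}(p')\le\mathrm{val}(p)$ for every pricing $p'$ differing from $p$ on at most $\rho$ vertices of $L$. *)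

theory Defs
  imports Complex_Main "HOL-Library.Extended_Nat" "HOL-Library.Extended_Real"
begin

text \<open>The graph is simple; an edge is stored as the pair of its \<open>L\<close>-end and its \<open>R\<close>-end.\<close>

record 'v lsp_instance =
  left :: "'v set"
  right :: "'v set"
  edges :: "('v \<times> 'v) set"
  capacity :: "'v \<Rightarrow> enat"
  budget :: "'v \<times> 'v \<Rightarrow> real"

definition price_set :: "'v lsp_instance \<Rightarrow> 'v \<Rightarrow> real set" where
  "price_set I u = budget I ` {e \<in> edges I. fst e = u}"

text \<open>The last condition says that no vertex of \<open>L\<close> is isolated: otherwise its set of admissible
  prices is empty, the instance has no pricing at all, and the maxima below are undefined.\<close>

definition lsp_instance :: "'v lsp_instance \<Rightarrow> bool" where
  "lsp_instance I \<longleftrightarrow>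
     finite (left I) \<and> finite (right I) \<and> left I \<inter> right I = {} \<and>
     edges I \<subseteq> left I \<times> right I \<and>
     (\<forall>e\<in>edges I. 0 \<le> budget I e) \<and>
     (\<forall>u\<in>left I. price_set I u \<noteq> {})"

text \<open>Prices vanish everywhere outside \<open>L\<close>, not only on \<open>R\<close>, so that a pricing is determined
  by its values on \<open>L\<close> and there are only finitely many pricings.\<close>

definition pricings :: "'v lsp_instance \<Rightarrow> ('v \<Rightarrow> real) set" where
  "pricings I = {p. (\<forall>u\<in>left I. p u \<in> price_set I u) \<and> (\<forall>w. w \<notin> left I \<longrightarrow> p w = 0)}"

definition feasible :: "'v lsp_instance \<Rightarrow> ('v \<Rightarrow> real) \<Rightarrow> ('v \<times> 'v) set \<Rightarrow> bool" where
  "feasible I p F \<longleftrightarrow>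
     F \<subseteq> edges I \<and>
     (\<forall>(u, v)\<in>F. p u + p v \<le> budget I (u, v)) \<and>
     (\<forall>w\<in>left I \<union> right I. enat (card {e \<in> F. fst e = w \<or> snd e = w}) \<le> capacity I w)"

definition val :: "'v lsp_instance \<Rightarrow> ('v \<Rightarrow> real) \<Rightarrow> real" where
  "val I p = Max {(\<Sum>(u, v)\<in>F. p u + p v) | F. feasible I p F}"

definition opt_val :: "'v lsp_instance \<Rightarrow> real" where
  "opt_val I = Max (val I ` pricings I)"

definition local_optima :: "'v lsp_instance \<Rightarrow> nat \<Rightarrow> ('v \<Rightarrow> real) set" where
  "local_optima I \<rho> =
     {p \<in> pricings I. \<forall>p'\<in>pricings I.
        card {u \<in> left I. p' u \<noteq> p u} \<le> \<rho> \<longrightarrow> val I p' \<le> val I p}"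

text \<open>The quotient is taken in the extended reals, so that a local optimum of value \<open>0\<close>
  in an instance of positive optimum contributes \<open>\<infinity>\<close>; there \<open>0 / 0 = 0\<close>.\<close>

definition locality_gap :: "'v lsp_instance \<Rightarrow> nat \<Rightarrow> ereal" where
  "locality_gap I \<rho> = Max {ereal (opt_val I) / ereal (val I p) | p. p \<in> local_optima I \<rho>}"

end

theory Submission
  imports Defs "HOL-Library.Nat_Bijection"
begin

text \<open>
  Take a layered acyclic digraph in which almost all in- and out-degrees are \<open>C\<close> and every small
  vertex set \<open>W\<close> induces fewer than \<open>|W|\<close> arcs. The vertices form \<open>L\<close> and the arcs form \<open>R\<close>;
  an arc has budget \<open>1\<close> at its tail and \<open>q = (2C - 1) / C\<close> at its head. Pricing everything at \<open>1\<close>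
  sells each arc to its tail, pricing everything at \<open>q\<close> sells each arc to its head.

  If only a small set \<open>S\<close> switches to \<open>q\<close>, the arcs it receives are taken from other vertices. These
  can compensate only by taking arcs from their own predecessors, and since the digraph is acyclic
  such a chain ends without loss only if it ends in an arc leaving \<open>S\<close>. Local sparsity bounds the
  number of such chains by \<open>|S|\<close>, so the gain \<open>q C |S| - C |S|\<close> is cancelled by the loss
  \<open>C |S| - |S|\<close>. Using many layers makes the share of the source layer negligible.

  The digraph has the most arcs among the locally sparse ones with degrees at most \<open>C\<close>
  (Erdos--Sachs): by maximality, all heads with
  a free slot lie in a ball of bounded size around any tail with a free slot.
\<close>

subsection \<open>Locally sparse layered digraphs\<close>

text \<open>Equivalently, the underlying undirected multigraph has no cycle of length at most
  \<open>K\<close>, where loops and pairs of opposite arcs count as cycles. The counting form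
  applies directly to unions of chains.\<close>

definition locally_sparse :: "nat \<Rightarrow> ('a \<times> 'a) set \<Rightarrow> bool" where
  "locally_sparse K G \<longleftrightarrow>
     (\<forall>W. W \<noteq> {} \<longrightarrow> finite W \<longrightarrow> card W \<le> K \<longrightarrow> card (G \<inter> W \<times> W) < card W)"

lemma card_arcs_by_tail:
  assumes "finite G" and "finite A"
  shows "card {x \<in> G. fst x \<in> A} = (\<Sum>u\<in>A. card (G `` {u}))"
proof -
  have "{x \<in> G. fst x \<in> A} = Sigma A (\<lambda>u. G `` {u})"
    by auto
  then show ?thesis
    using assms by (simp add: card_SigmaI finite_Image)
qed

lemma card_arcs_by_head:
  assumes "finite G" and "finite A"
  shows "card {x \<in> G. snd x \<in> A} = (\<Sum>v\<in>A. card (G\<inverse> `` {v}))"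
proof -
  have "{x \<in> G\<inverse>. fst x \<in> A} = prod.swap ` {x \<in> G. snd x \<in> A}"
    by force
  then have "card {x \<in> G\<inverse>. fst x \<in> A} = card {x \<in> G. snd x \<in> A}"
    by (simp add: card_image)
  then show ?thesis
    using card_arcs_by_tail[of "G\<inverse>" A] assms by simp
qed

text \<open>A violating set \<open>W\<close> contains both ends of the new arc and induces at least
  \<open>card W - 1\<close> old arcs. If \<open>v\<close> lay outside the component of
  \<open>u\<close> within \<open>W\<close>, sparsity of the two parts would allow at most
  \<open>card W - 2\<close>.\<close>

lemma insert_not_sparse_imp_near:
  assumes sp: "locally_sparse K G" and fin: "finite G"
    and nsp: "\<not> locally_sparse K (insert (u, v) G)"
  shows "\<exists>i\<le>2 * K. (u, v) \<in> (G \<union> G\<inverse>) ^^ i"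
proof -
  obtain W where W: "W \<noteq> {}" "finite W" "card W \<le> K"
    and ge: "card W \<le> card (insert (u, v) G \<inter> W \<times> W)"
    using nsp unfolding locally_sparse_def by (meson not_less)
  have lt: "card (G \<inter> W \<times> W) < card W"
    using sp W unfolding locally_sparse_def by blast
  have uv: "u \<in> W" "v \<in> W"
  proof -
    have "insert (u, v) G \<inter> W \<times> W = G \<inter> W \<times> W" if "\<not> (u \<in> W \<and> v \<in> W)"
      using that by auto
    then show "u \<in> W" "v \<in> W"
      using ge lt by (metis not_less)+
  qed
  have "card (insert (u, v) G \<inter> W \<times> W) \<le> Suc (card (G \<inter> W \<times> W))"
    using uv by (simp add: card_insert_le_m1 card_insert_if fin)
  with ge have ge': "card W \<le> Suc (card (G \<inter> W \<times> W))"
    by linarith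
  define R where "R = (G \<inter> W \<times> W) \<union> (G \<inter> W \<times> W)\<inverse>"
  have finR: "finite R"
    using fin by (simp add: R_def)
  define W1 where "W1 = {w \<in> W. (u, w) \<in> R\<^sup>*}"
  define W2 where "W2 = W - W1"
  have "v \<in> W1"
  proof (rule ccontr)
    assume "v \<notin> W1"
    have ne: "W1 \<noteq> {}" "W2 \<noteq> {}"
      using uv \<open>v \<notin> W1\<close> by (auto simp: W1_def W2_def)
    have f: "finite W1" "finite W2"
      using W by (auto simp: W1_def W2_def)
    have cW: "card W = card W1 + card W2"
      using W by (simp add: W2_def W1_def card_Diff_subset card_mono)
    have "x \<in> W1 \<longleftrightarrow> y \<in> W1" if "(x, y) \<in> G \<inter> W \<times> W" for x y
    proof -
      have "(x, y) \<in> R" "(y, x) \<in> R" "x \<in> W" "y \<in> W"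
        using that by (auto simp: R_def)
      then show ?thesis
        unfolding W1_def by (auto intro: rtrancl_into_rtrancl)
    qed
    then have "G \<inter> W \<times> W \<subseteq> (G \<inter> W1 \<times> W1) \<union> (G \<inter> W2 \<times> W2)"
      by (auto simp: W2_def)
    then have "card (G \<inter> W \<times> W) \<le> card ((G \<inter> W1 \<times> W1) \<union> (G \<inter> W2 \<times> W2))"
      using fin by (intro card_mono) auto
    also have "\<dots> \<le> card (G \<inter> W1 \<times> W1) + card (G \<inter> W2 \<times> W2)"
      by (rule card_Un_le)
    finally have "card (G \<inter> W \<times> W) \<le> \<dots>" .
    moreover have "card (G \<inter> W1 \<times> W1) < card W1" "card (G \<inter> W2 \<times> W2) < card W2"
      using sp ne f cW W(3) unfolding locally_sparse_def by auto
    ultimately show False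
      using ge' cW by linarith
  qed
  then have "(u, v) \<in> R\<^sup>*"
    by (simp add: W1_def)
  then obtain i where i: "i \<le> card R" "(u, v) \<in> R ^^ i"
    using rtrancl_finite_eq_relpow[OF finR] by auto
  \<comment> \<open>The path length is bounded by the number of pairs in \<open>R\<close>, which
    holds each arc in both orientations; hence the crude radius \<open>2 * K\<close>.\<close>
  have "card R \<le> card (G \<inter> W \<times> W) + card ((G \<inter> W \<times> W)\<inverse>)"
    unfolding R_def by (rule card_Un_le)
  then have "card R \<le> 2 * K"
    using lt W(3) by simp
  moreover have "R ^^ i \<subseteq> (G \<union> G\<inverse>) ^^ i"
  proof (induction i)
    case (Suc i)
    have "R \<subseteq> G \<union> G\<inverse>"
      by (auto simp: R_def)
    with Suc show ?case
      by (auto simp del: relpow.simps simp: relpow.simps(2) intro!: relcomp_mono)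
  qed simp
  ultimately show ?thesis
    using i by (meson le_trans subsetD)
qed

lemma card_relpow_Image_le:
  fixes R :: "('a \<times> 'a) set"
  assumes fin: "finite R" and deg: "\<And>w. card (R `` {w}) \<le> d"
  shows "finite ((R ^^ i) `` {u}) \<and> card ((R ^^ i) `` {u}) \<le> d ^ i"
proof (induction i)
  case 0
  have "(R ^^ 0) `` {u} = {u}"
    by auto
  then show ?case by simp
next
  case (Suc i)
  let ?B = "(R ^^ i) `` {u}"
  have eq: "(R ^^ Suc i) `` {u} = (\<Union>w\<in>?B. R `` {w})"
    by auto
  have "card (\<Union>w\<in>?B. R `` {w}) \<le> (\<Sum>w\<in>?B. card (R `` {w}))"
    using Suc by (intro card_UN_le) auto
  also have "\<dots> \<le> (\<Sum>w\<in>?B. d)"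
    by (intro sum_mono deg)
  also have "\<dots> \<le> d ^ i * d"
    using Suc by simp
  finally show ?case
    unfolding eq using Suc fin by (simp add: finite_Image mult.commute)
qed

lemma card_ball_le:
  assumes fin: "finite G" and out: "\<And>w. card (G `` {w}) \<le> C"
    and inn: "\<And>w. card (G\<inverse> `` {w}) \<le> C"
    and sub: "\<And>v. v \<in> B \<Longrightarrow> \<exists>i\<le>r. (u, v) \<in> (G \<union> G\<inverse>) ^^ i"
  shows "card B \<le> (\<Sum>i\<le>r. (2 * C) ^ i)"
proof -
  let ?R = "G \<union> G\<inverse>"
  have deg: "card (?R `` {w}) \<le> 2 * C" for w
  proof -
    have "?R `` {w} = G `` {w} \<union> G\<inverse> `` {w}"
      by auto
    then have "card (?R `` {w}) \<le> card (G `` {w}) + card (G\<inverse> `` {w})"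
      by (metis card_Un_le)
    then show ?thesis
      using out[of w] inn[of w] by linarith
  qed
  have ball: "finite ((?R ^^ i) `` {u})" "card ((?R ^^ i) `` {u}) \<le> (2 * C) ^ i" for i
    using card_relpow_Image_le[of ?R "2 * C" i u] fin deg by auto
  have "B \<subseteq> (\<Union>i\<le>r. (?R ^^ i) `` {u})"
    using sub by fastforce
  then have "card B \<le> card (\<Union>i\<le>r. (?R ^^ i) `` {u})"
    using ball by (intro card_mono) auto
  also have "\<dots> \<le> (\<Sum>i\<le>r. card ((?R ^^ i) `` {u}))"
    by (intro card_UN_le) auto
  also have "\<dots> \<le> (\<Sum>i\<le>r. (2 * C) ^ i)"
    by (intro sum_mono ball)
  finally show ?thesis .
qed

text \<open>Layers are blocks of \<open>n\<close> consecutive numbers. Take an admissible graph with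
  the most arcs. If some tail in layer \<open>j\<close> has a free slot, a new arc from it to an
  unfilled head in the next layer can fail only through sparsity. So the unfilled heads lie in one
  ball, and at least \<open>n - T\<close> heads are full.\<close>

lemma exists_sparse_layered_graph:
  fixes C N K n :: nat
  assumes "K \<ge> 1" and "n \<ge> 1"
  defines "m \<equiv> Suc N * n"
  obtains G where "G \<subseteq> {..<m} \<times> {..<m}"
    and "\<And>u v. (u, v) \<in> G \<Longrightarrow> v div n = Suc (u div n)"
    and "\<And>u. card (G `` {u}) \<le> C" and "\<And>v. card (G\<inverse> `` {v}) \<le> C"
    and "locally_sparse K G"
    and "N * (C * (n - (\<Sum>i\<le>2 * K. (2 * C) ^ i))) \<le> card G"
proof -
  define adm where "adm G \<longleftrightarrow> G \<subseteq> {..<m} \<times> {..<m} \<and>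
           (\<forall>(u, v)\<in>G. v div n = Suc (u div n)) \<and>
           (\<forall>u. card (G `` {u}) \<le> C) \<and> (\<forall>v. card (G\<inverse> `` {v}) \<le> C) \<and>
           locally_sparse K G" for G
  have "adm {}"
    by (auto simp: adm_def locally_sparse_def card_gt_0_iff)
  moreover have "finite {G. adm G}"
    by (rule finite_subset[of _ "Pow ({..<m} \<times> {..<m})"]) (auto simp: adm_def)
  ultimately obtain G where G: "adm G" and maxG: "\<And>G'. adm G' \<Longrightarrow> card G' \<le> card G"
  proof -
    assume fin: "finite {G. adm G}" and "adm {}"
    then have "Max (card ` {G. adm G}) \<in> card ` {G. adm G}"
      by (intro Max_in) auto
    then obtain G where "adm G" "card G = Max (card ` {G. adm G})"
      by auto
    then show thesis
      using fin that[of G] by simp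
  qed
  define T where "T = (\<Sum>i\<le>2 * K. (2 * C) ^ i)"
  have sub: "G \<subseteq> {..<m} \<times> {..<m}" and lay: "\<And>u v. (u, v) \<in> G \<Longrightarrow> v div n = Suc (u div n)"
    and out: "\<And>u. card (G `` {u}) \<le> C" and inn: "\<And>v. card (G\<inverse> `` {v}) \<le> C"
    and sp: "locally_sparse K G"
    using G by (auto simp: adm_def)
  have fin: "finite G"
    using sub by (rule finite_subset) auto
  define L where "L j = {j * n..<Suc j * n}" for j
  have L: "v \<in> L j \<longleftrightarrow> v div n = j" for v j
    using assms(2) unfolding L_def by (auto simp: div_nat_eqI dividend_less_times_div mult.commute)
  have finL: "finite (L j)" and cardL: "card (L j) = n" for j
    by (auto simp: L_def)
  have Lm: "L j \<subseteq> {..<m}" if "j \<le> N" for j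
  proof -
    have "Suc j * n \<le> m"
      unfolding m_def using that by (intro mult_le_mono1) simp
    then show ?thesis
      by (auto simp: L_def)
  qed
  have layer_ge: "C * (n - T) \<le> card {x \<in> G. fst x \<in> L j}" if j: "j < N" for j
  proof (cases "\<forall>u\<in>L j. card (G `` {u}) = C")
    case True
    then have "card {x \<in> G. fst x \<in> L j} = n * C"
      using card_arcs_by_tail[OF fin finL[of j]] by (simp add: cardL)
    then show ?thesis
      by (simp add: mult.commute)
  next
    case False
    then obtain u where u: "u \<in> L j" "card (G `` {u}) < C"
      using out by (meson le_neq_implies_less)
    define B where "B = {v \<in> L (Suc j). card (G\<inverse> `` {v}) < C}"
    have near: "\<exists>i\<le>2 * K. (u, v) \<in> (G \<union> G\<inverse>) ^^ i" if v: "v \<in> B" for v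
    \<comment> \<open>Maximality says nothing about an arc already present, but such an arc puts
      \<open>v\<close> at distance 1.\<close>
    proof (cases "(u, v) \<in> G")
      case True
      then have "(u, v) \<in> (G \<union> G\<inverse>) ^^ 1"
        by auto
      then show ?thesis
        using assms(1) by (intro exI[of _ 1]) auto
    next
      case new: False
      let ?G = "insert (u, v) G"
      have v': "v \<in> L (Suc j)" "card (G\<inverse> `` {v}) < C"
        using v by (auto simp: B_def)
      \<comment> \<open>The conditions checked next all survive the insertion, so sparsity must be
        the one that fails.\<close>
      have "\<not> adm ?G"
        using maxG[of ?G] new fin by auto
      moreover have "?G \<subseteq> {..<m} \<times> {..<m}"
        using sub Lm[of j] Lm[of "Suc j"] j u v' by auto
      moreover have "\<forall>(x, y)\<in>?G. y div n = Suc (x div n)"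
        using lay u v' by (auto simp: L)
      moreover have "card (?G `` {w}) \<le> C" for w
      proof -
        have "?G `` {w} = (if w = u then insert v (G `` {w}) else G `` {w})"
          by auto
        then show ?thesis
          using out[of w] u fin by (simp add: card_insert_if finite_Image)
      qed
      moreover have "card (?G\<inverse> `` {w}) \<le> C" for w
      proof -
        have "?G\<inverse> `` {w} = (if w = v then insert u (G\<inverse> `` {w}) else G\<inverse> `` {w})"
          by auto
        then show ?thesis
          using inn[of w] v' fin by (simp add: card_insert_if finite_Image)
      qed
      ultimately have "\<not> locally_sparse K ?G"
        unfolding adm_def by blast
      then show ?thesis
        using insert_not_sparse_imp_near[OF sp fin] by blast
    qed
    have cB: "card B \<le> T"
      unfolding T_def by (rule card_ball_le[OF fin out inn near])
    have finB: "finite B"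
      by (simp add: B_def finL)
    have "n - T \<le> card (L (Suc j) - B)"
    proof -
      have "B \<subseteq> L (Suc j)"
        by (auto simp: B_def)
      then show ?thesis
        using cB by (simp add: card_Diff_subset finB cardL diff_le_mono2)
    qed
    then have "C * (n - T) \<le> (\<Sum>v\<in>L (Suc j) - B. C)"
      by (simp add: mult.commute)
    also have "\<dots> \<le> (\<Sum>v\<in>L (Suc j) - B. card (G\<inverse> `` {v}))"
      by (intro sum_mono) (auto simp: B_def)
    also have "\<dots> \<le> (\<Sum>v\<in>L (Suc j). card (G\<inverse> `` {v}))"
      by (intro sum_mono2) (auto simp: finL)
    also have "\<dots> = card {x \<in> G. snd x \<in> L (Suc j)}"
      by (rule card_arcs_by_head[OF fin finL, symmetric])
    also have "{x \<in> G. snd x \<in> L (Suc j)} = {x \<in> G. fst x \<in> L j}"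
      using lay by (force simp: L)
    finally show ?thesis .
  qed
  have "N * (C * (n - T)) = (\<Sum>j<N. C * (n - T))"
    by simp
  also have "\<dots> \<le> (\<Sum>j<N. card {x \<in> G. fst x \<in> L j})"
    by (intro sum_mono layer_ge) auto
  also have "\<dots> = card (\<Union>j<N. {x \<in> G. fst x \<in> L j})"
    by (rule card_UN_disjoint[symmetric]) (auto simp: fin L)
  also have "\<dots> \<le> card G"
    by (intro card_mono fin) auto
  finally show thesis
    using that[OF sub lay out inn sp] unfolding T_def by simp
qed

subsection \<open>Values and locality gaps\<close>

lemma lsp_finite_edges: "lsp_instance I \<Longrightarrow> finite (edges I)"
  unfolding lsp_instance_def by (meson finite_SigmaI finite_subset)

lemma finite_revenues:
  assumes "lsp_instance I"
  shows "finite {(\<Sum>(u, v)\<in>F. p u + p v) | F. feasible I p F}"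
proof -
  have "{(\<Sum>(u, v)\<in>F. p u + p v) | F. feasible I p F}
      \<subseteq> (\<lambda>F. \<Sum>(u, v)\<in>F. p u + p v) ` Pow (edges I)"
    by (auto simp: feasible_def)
  then show ?thesis
    using lsp_finite_edges[OF assms] by (simp add: finite_subset)
qed

lemma revenue_le_val:
  assumes "lsp_instance I" and "feasible I p F"
  shows "(\<Sum>(u, v)\<in>F. p u + p v) \<le> val I p"
  unfolding val_def using finite_revenues[OF assms(1)] assms(2) by (intro Max_ge) auto

lemma val_leI:
  assumes "lsp_instance I" and "\<And>F. feasible I p F \<Longrightarrow> (\<Sum>(u, v)\<in>F. p u + p v) \<le> c"
  shows "val I p \<le> c"
proof -
  \<comment> \<open>The empty sale makes the set under \<open>Max\<close> nonempty.\<close>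
  have "feasible I p {}"
    by (simp add: feasible_def zero_enat_def[symmetric])
  then show ?thesis
    unfolding val_def using finite_revenues[OF assms(1)] assms(2) by (subst Max_le_iff) auto
qed

lemma finite_pricings:
  assumes "lsp_instance I"
  shows "finite (pricings I)"
proof (rule finite_subset)
  show "pricings I \<subseteq> {p. \<forall>w. (w \<in> left I \<longrightarrow> p w \<in> (\<Union>u\<in>left I. price_set I u)) \<and>
      (w \<notin> left I \<longrightarrow> p w = 0)}"
    by (auto simp: pricings_def)
  show "finite {p :: 'a \<Rightarrow> real. \<forall>w. (w \<in> left I \<longrightarrow> p w \<in> (\<Union>u\<in>left I. price_set I u)) \<and>
      (w \<notin> left I \<longrightarrow> p w = 0)}"
    using assms lsp_finite_edges[OF assms]
    by (intro finite_set_of_finite_funs) (auto simp: lsp_instance_def price_set_def)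
qed

lemma val_le_opt_val:
  assumes "lsp_instance I" and "p \<in> pricings I"
  shows "val I p \<le> opt_val I"
  unfolding opt_val_def using finite_pricings[OF assms(1)] assms(2) by (intro Max_ge) auto

lemma ratio_le_locality_gap:
  assumes "lsp_instance I" and "p \<in> local_optima I \<rho>"
  shows "ereal (opt_val I) / ereal (val I p) \<le> locality_gap I \<rho>"
proof -
  have "finite (local_optima I \<rho>)"
    using finite_pricings[OF assms(1)] by (simp add: local_optima_def)
  then have "finite {ereal (opt_val I) / ereal (val I p) | p. p \<in> local_optima I \<rho>}"
    by simp
  then show ?thesis
    unfolding locality_gap_def using assms(2) by (intro Max_ge) auto
qed

subsection \<open>The pricing instance of a digraph\<close>

text \<open>Items are the pairs in \<open>X\<close>; those whose second component lies outside \<open>V\<close> are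
  dummies that pad every out-degree to exactly \<open>C\<close>.\<close>

locale pricing_graph =
  fixes V :: "nat set" and X :: "(nat \<times> nat) set" and rk :: "nat \<Rightarrow> nat" and C N \<rho> :: nat
  assumes finV: "finite V" and finX: "finite X"
    and tail_V: "x \<in> X \<Longrightarrow> fst x \<in> V"
    and outdeg: "u \<in> V \<Longrightarrow> card (X `` {u}) = C"
    and indeg: "v \<in> V \<Longrightarrow> card (X\<inverse> `` {v}) \<le> C"
    and rk_step: "(u, v) \<in> X \<Longrightarrow> v \<in> V \<Longrightarrow> rk v = Suc (rk u)"
    and rk_le: "v \<in> V \<Longrightarrow> rk v \<le> N"
    and sparse: "locally_sparse (\<rho> + \<rho> * C * Suc N) (X \<inter> V \<times> V)"
    and C2: "C \<ge> 2"
begin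

abbreviation arcs :: "(nat \<times> nat) set" where
  "arcs \<equiv> X \<inter> V \<times> V"

section \<open>Compensating chains and local sparsity\<close>

text \<open>\<open>rk\<close> grows by one along each arc and never exceeds \<open>N\<close>, so
  iterating \<open>nxt\<close> from \<open>y\<close> reaches \<open>S\<close> after at most
  \<open>Suc N\<close> vertices of \<open>U\<close>; these form \<open>P\<close>.\<close>

lemma successor_path:
  assumes nxt: "\<And>v. v \<in> U \<Longrightarrow> (v, nxt v) \<in> arcs \<and> nxt v \<in> U \<union> S"
    and y: "y \<in> U \<union> S" and UV: "U \<subseteq> V"
  shows "\<exists>P\<subseteq>U. finite P \<and> card P \<le> Suc N \<and> y \<in> P \<union> S \<and> (\<forall>v\<in>P. nxt v \<in> P \<union> S)"
proof -
  \<comment> \<open>The bound is sharpened to depend on \<open>rk y\<close>, so that each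
    application of \<open>nxt\<close> pays for one more vertex.\<close>
  have "\<exists>P\<subseteq>U. finite P \<and> card P \<le> Suc N - rk y \<and> y \<in> P \<union> S \<and> (\<forall>v\<in>P. nxt v \<in> P \<union> S)"
    using y
  proof (induction "N - rk y" arbitrary: y rule: less_induct)
    case less
    show ?case
    proof (cases "y \<in> S")
      case True
      then show ?thesis
        by (intro exI[of _ "{}"]) auto
    next
      case False
      then have yU: "y \<in> U"
        using less by auto
      have a: "(y, nxt y) \<in> arcs" "nxt y \<in> U \<union> S"
        using nxt[OF yU] by auto
      then have r: "rk (nxt y) = Suc (rk y)" "rk (nxt y) \<le> N"
        using rk_step rk_le by auto
      then have "N - rk (nxt y) < N - rk y"
        by linarith
      from less.hyps[OF this a(2)] obtain P where P: "P \<subseteq> U" "finite P"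
        "card P \<le> Suc N - rk (nxt y)" "nxt y \<in> P \<union> S" "\<forall>v\<in>P. nxt v \<in> P \<union> S"
        by blast
      have "card (insert y P) \<le> Suc (card P)"
        by (rule card_insert_le_m1) auto
      also have "\<dots> \<le> Suc N - rk y"
        using P(3) r by linarith
      finally have "card (insert y P) \<le> Suc N - rk y" .
      then show ?thesis
        using P yU by (intro exI[of _ "insert y P"]) auto
    qed
  qed
  then show ?thesis
    by (meson diff_le_self le_trans)
qed

text \<open>At most \<open>\<rho> * C\<close> arcs leave \<open>S\<close>, and following
  \<open>nxt\<close> from their heads yields a set \<open>P\<close> of at most
  \<open>\<rho> * C * Suc N\<close> vertices; this explains the constant in \<open>sparse\<close>.
  Within \<open>S \<union> P\<close>, one \<open>nxt\<close> arc per vertex of \<open>P\<close> uses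
  up \<open>card P\<close> arcs, so sparsity leaves fewer than \<open>card S\<close> for those
  starting in \<open>S\<close>.\<close>

lemma returning_arcs_le:
  assumes SV: "S \<subseteq> V" and cS: "card S \<le> \<rho>" and UV: "U \<subseteq> V - S"
    and nxt: "\<And>v. v \<in> U \<Longrightarrow> (v, nxt v) \<in> arcs \<and> nxt v \<in> U \<union> S"
  shows "card {x \<in> arcs. fst x \<in> S \<and> snd x \<in> U \<union> S} \<le> card S"
\<comment> \<open>Sparsity does not cover the empty set, which \<open>S \<union> P\<close> would be
  in the first case.\<close>
proof (cases "S = {}")
  case True
  then show ?thesis by simp
next
  case False
  define A0 where "A0 = {x \<in> arcs. fst x \<in> S \<and> snd x \<in> U \<union> S}"
  have finS: "finite S" and finA: "finite A0"
    using finite_subset[OF SV finV] finX by (auto simp: A0_def)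
  have "\<forall>x\<in>A0. \<exists>P\<subseteq>U. finite P \<and> card P \<le> Suc N \<and> snd x \<in> P \<union> S \<and> (\<forall>v\<in>P. nxt v \<in> P \<union> S)"
    using successor_path[OF nxt] UV by (auto simp: A0_def)
  then obtain p where p: "\<And>x. x \<in> A0 \<Longrightarrow> p x \<subseteq> U \<and> finite (p x) \<and> card (p x) \<le> Suc N \<and>
      snd x \<in> p x \<union> S \<and> (\<forall>v\<in>p x. nxt v \<in> p x \<union> S)"
    by metis
  define P where "P = (\<Union>x\<in>A0. p x)"
  have P: "finite P" "P \<subseteq> U" "\<And>v. v \<in> P \<Longrightarrow> nxt v \<in> P \<union> S" "\<And>x. x \<in> A0 \<Longrightarrow> snd x \<in> P \<union> S"
    unfolding P_def using finA p by blast+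
  have "A0 \<subseteq> {x \<in> X. fst x \<in> S}"
    by (auto simp: A0_def)
  then have "card A0 \<le> card {x \<in> X. fst x \<in> S}"
    by (intro card_mono) (auto simp: finX)
  also have "\<dots> = (\<Sum>u\<in>S. C)"
    unfolding card_arcs_by_tail[OF finX finS] by (intro sum.cong) (use outdeg SV in auto)
  also have "\<dots> \<le> \<rho> * C"
    using cS by simp
  finally have cA: "card A0 \<le> \<rho> * C" .
  have "card P \<le> (\<Sum>x\<in>A0. card (p x))"
    unfolding P_def by (intro card_UN_le finA)
  also have "\<dots> \<le> (\<Sum>x\<in>A0. Suc N)"
    by (intro sum_mono) (use p in auto)
  also have "\<dots> \<le> \<rho> * C * Suc N"
    using cA by (metis mult_le_mono1 of_nat_id sum_constant)
  finally have cP: "card P \<le> \<rho> * C * Suc N" .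
  define W where "W = S \<union> P"
  have disj: "S \<inter> P = {}"
    using P UV by auto
  have cW: "card W = card S + card P"
    unfolding W_def using finS P disj by (simp add: card_Un_disjoint)
  have W: "finite W" "W \<noteq> {}" "card W \<le> \<rho> + \<rho> * C * Suc N"
    using finS P False cW cP cS by (auto simp: W_def)
  let ?Q = "(\<lambda>v. (v, nxt v)) ` P"
  have "A0 \<union> ?Q \<subseteq> arcs \<inter> W \<times> W"
    using P nxt by (auto simp: A0_def W_def) (metis Un_iff snd_conv)+
  then have "card (A0 \<union> ?Q) \<le> card (arcs \<inter> W \<times> W)"
    using finX by (intro card_mono) auto
  also have "\<dots> < card W"
    using sparse W unfolding locally_sparse_def by blast
  finally have "card (A0 \<union> ?Q) < card W" .
  moreover have "card (A0 \<union> ?Q) = card A0 + card ?Q"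
    using finA P disj by (intro card_Un_disjoint) (auto simp: A0_def)
  moreover have "card ?Q = card P"
    by (intro card_image) (auto simp: inj_on_def)
  ultimately show ?thesis
    using cW unfolding A0_def by linarith
qed

text \<open>If \<open>H\<close> is the set of arcs sold to their heads, the truncated difference of out- and
  in-degree in \<open>H\<close> bounds the number of unused slots of a vertex. Summing over the ancestors
  of \<open>S\<close> telescopes, and only arcs by which \<open>S\<close> re-enters this set are lost.\<close>

lemma card_arcs_into_le_deficit:
  assumes SV: "S \<subseteq> V" and cS: "card S \<le> \<rho>" and H: "H \<subseteq> arcs"
  shows "card {x \<in> H. snd x \<in> S} \<le>
           card S + (\<Sum>v\<in>V - S. card (H `` {v}) - card (H\<inverse> `` {v}))"
proof -
  \<comment> \<open>The ancestors of \<open>S\<close> outside \<open>S\<close>; each has a successor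
    in \<open>U\<close> or \<open>S\<close>, which supplies \<open>nxt\<close>.\<close>
  define U where "U = {v \<in> V - S. \<exists>t\<in>S. (v, t) \<in> arcs\<^sup>+}"
  have UV: "U \<subseteq> V - S"
    by (auto simp: U_def)
  have "\<exists>w. (v, w) \<in> arcs \<and> w \<in> U \<union> S" if v: "v \<in> U" for v
  proof -
    obtain t where t: "t \<in> S" "(v, t) \<in> arcs\<^sup>+"
      using v unfolding U_def by blast
    from tranclD[OF t(2)] obtain w where w: "(v, w) \<in> arcs" "(w, t) \<in> arcs\<^sup>*"
      by blast
    show ?thesis
    proof (cases "w \<in> S")
      case True
      then show ?thesis using w by blast
    next
      case False
      then have "(w, t) \<in> arcs\<^sup>+"
        using w(2) t(1) by (auto dest: rtranclD)
      then show ?thesis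
        using w False t(1) by (intro exI[of _ w]) (auto simp: U_def)
    qed
  qed
  then obtain nxt where nxt: "\<And>v. v \<in> U \<Longrightarrow> (v, nxt v) \<in> arcs \<and> nxt v \<in> U \<union> S"
    by metis
  let ?A0 = "{x \<in> arcs. fst x \<in> S \<and> snd x \<in> U \<union> S}"
  have A0: "card ?A0 \<le> card S"
    by (rule returning_arcs_le[OF SV cS UV nxt])
  have finH: "finite H"
    using H finX by (auto intro: finite_subset)
  have finU: "finite U"
    using UV finV by (auto intro: finite_subset)
  \<comment> \<open>As \<open>U \<union> S\<close> is closed under predecessors, an arc of
    \<open>H\<close> into it starts in \<open>U\<close> or belongs to \<open>?A0\<close>.\<close>
  have pred: "w \<in> U \<union> S" if a: "(w, v) \<in> H" and v: "v \<in> U \<union> S" for w v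
  proof (cases "w \<in> S")
    case False
    have a': "(w, v) \<in> arcs"
      using a H by auto
    obtain t where "t \<in> S" "(v, t) \<in> arcs\<^sup>*"
      using v by (auto simp: U_def dest: trancl_into_rtrancl)
    then have "t \<in> S" "(w, t) \<in> arcs\<^sup>+"
      using a' by (auto intro: rtrancl_into_trancl2)
    then show ?thesis
      using False a' by (auto simp: U_def)
  qed simp
  have "card {x \<in> H. snd x \<in> S} + card {x \<in> H. snd x \<in> U}
      = card ({x \<in> H. snd x \<in> S} \<union> {x \<in> H. snd x \<in> U})"
    using finH UV by (intro card_Un_disjoint[symmetric]) auto
  also have "\<dots> \<le> card ({x \<in> H. fst x \<in> U} \<union> ?A0)"
    using H pred finH finX by (intro card_mono) (auto, blast+)
  also have "\<dots> \<le> card {x \<in> H. fst x \<in> U} + card ?A0"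
    by (rule card_Un_le)
  also have "card {x \<in> H. fst x \<in> U} = (\<Sum>v\<in>U. card (H `` {v}))"
    by (rule card_arcs_by_tail[OF finH finU])
  \<comment> \<open>\<open>a \<le> (a - b) + b\<close> holds for truncated subtraction too; the
    in-degree sum will cancel against the arcs into \<open>U\<close> on the left.\<close>
  also have "(\<Sum>v\<in>U. card (H `` {v}))
      \<le> (\<Sum>v\<in>U. (card (H `` {v}) - card (H\<inverse> `` {v})) + card (H\<inverse> `` {v}))"
    by (intro sum_mono) auto
  also have "\<dots> = (\<Sum>v\<in>U. card (H `` {v}) - card (H\<inverse> `` {v})) + card {x \<in> H. snd x \<in> U}"
    by (simp add: sum.distrib card_arcs_by_head[OF finH finU])
  also have "(\<Sum>v\<in>U. card (H `` {v}) - card (H\<inverse> `` {v}))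
      \<le> (\<Sum>v\<in>V - S. card (H `` {v}) - card (H\<inverse> `` {v}))"
    by (intro sum_mono2) (use finV UV in auto)
  finally show ?thesis
    using A0 by linarith
qed

section \<open>The instance with prices 1 and \<open>high\<close>\<close>

text \<open>The target ratio. It satisfies \<open>C * (high - 1) = C - 1\<close>, which balances the
  gain on the switched vertices against the loss elsewhere.\<close>

definition high :: real where
  "high = (2 * real C - 1) / real C"

text \<open>The shift beyond \<open>Max V\<close> keeps item vertices apart from \<open>V\<close>,
  both being natural numbers.\<close>

definition item :: "nat \<times> nat \<Rightarrow> nat" where
  "item x = Suc (Max V) + prod_encode x"

definition tail_edges :: "(nat \<times> nat) set" where
  "tail_edges = (\<lambda>x. (fst x, item x)) ` X"

text \<open>Only genuine arcs get a head edge; a dummy can be sold to its tail alone.\<close>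

definition head_edges :: "(nat \<times> nat) set" where
  "head_edges = (\<lambda>x. (snd x, item x)) ` arcs"

definition inst :: "nat lsp_instance" where
  "inst = \<lparr>left = V, right = item ` X, edges = tail_edges \<union> head_edges,
     capacity = (\<lambda>w. if w \<in> V then enat C else 1),
     budget = (\<lambda>e. if e \<in> tail_edges then 1 else high)\<rparr>"

lemma inst_simps [simp]:
  "left inst = V" "right inst = item ` X" "edges inst = tail_edges \<union> head_edges"
  "capacity inst = (\<lambda>w. if w \<in> V then enat C else 1)"
  "budget inst = (\<lambda>e. if e \<in> tail_edges then 1 else high)"
  by (simp_all add: inst_def)

lemma high_gt_1: "high > 1"
  using C2 by (simp add: high_def field_simps)

lemma item_notin_V: "item x \<notin> V"
  using Max_ge[OF finV, of "item x"] by (auto simp: item_def)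

lemma capacity_left: "\<forall>u\<in>left inst. capacity inst u = enat C"
  by simp

lemma capacity_right: "\<forall>v\<in>right inst. capacity inst v = 1"
  using item_notin_V by auto

lemma item_eq_iff [simp]: "item x = item y \<longleftrightarrow> x = y"
  by (simp add: item_def)

lemma arc_ends_neq: "x \<in> arcs \<Longrightarrow> fst x \<noteq> snd x"
  using rk_step[of "fst x" "snd x"] by auto

text \<open>An item determines its arc, and layering excludes loops. Hence head edges really have
  budget \<open>high\<close>.\<close>

lemma head_edges_not_tail: "e \<in> head_edges \<Longrightarrow> e \<notin> tail_edges"
  using arc_ends_neq unfolding head_edges_def tail_edges_def by fastforce

text \<open>Padding gives every vertex, even in the last layer, an outgoing item.\<close>

lemma one_in_price_set:
  assumes "u \<in> V"
  shows "1 \<in> price_set inst u"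
proof -
  have "X `` {u} \<noteq> {}"
    using outdeg[OF assms] C2 by auto
  then obtain w where "(u, w) \<in> X"
    by auto
  then have "(u, item (u, w)) \<in> tail_edges"
    by (force simp: tail_edges_def)
  then show ?thesis
    unfolding price_set_def by (force intro!: image_eqI[of _ _ "(u, item (u, w))"])
qed

lemma high_in_price_set:
  assumes "x \<in> arcs"
  shows "high \<in> price_set inst (snd x)"
proof -
  have "(snd x, item x) \<in> head_edges"
    using assms by (auto simp: head_edges_def)
  then show ?thesis
    unfolding price_set_def using head_edges_not_tail
    by (force intro!: image_eqI[of _ _ "(snd x, item x)"])
qed

lemma price_set_subset: "price_set inst u \<subseteq> {1, high}"
  by (auto simp: price_set_def)

lemma lsp_instance_inst: "lsp_instance inst"
  unfolding lsp_instance_def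
proof (intro conjI)
  show "\<forall>u\<in>left inst. price_set inst u \<noteq> {}"
    using one_in_price_set by fastforce
qed (use finV finX item_notin_V tail_V high_gt_1 in \<open>auto simp: tail_edges_def head_edges_def\<close>)

text \<open>A sale is described by the map \<open>g\<close> from sold items to their
  \<open>L\<close>-ends, so the capacities on the item side hold automatically.\<close>

lemma assignment_le_val:
  assumes p: "p \<in> pricings inst" and Y: "Y \<subseteq> X" and gV: "g ` Y \<subseteq> V"
    and edge: "\<And>x. x \<in> Y \<Longrightarrow> (g x, item x) \<in> edges inst"
    and budget: "\<And>x. x \<in> Y \<Longrightarrow> p (g x) \<le> budget inst (g x, item x)"
    and cap: "\<And>w. w \<in> V \<Longrightarrow> card {x \<in> Y. g x = w} \<le> C"
  shows "(\<Sum>x\<in>Y. p (g x)) \<le> val inst p"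
proof -
  let ?e = "\<lambda>x. (g x, item x)"
  let ?F = "?e ` Y"
  have p0: "p (item x) = 0" for x
    using p item_notin_V by (auto simp: pricings_def)
  have finY: "finite Y"
    using Y finX by (rule finite_subset)
  have capacities: "enat (card {e \<in> ?F. fst e = w \<or> snd e = w}) \<le> capacity inst w"
    if "w \<in> V \<union> item ` X" for w
  proof (cases "w \<in> V")
    case True
    then have "{e \<in> ?F. fst e = w \<or> snd e = w} = ?e ` {x \<in> Y. g x = w}"
      using item_notin_V by auto
    then have "card {e \<in> ?F. fst e = w \<or> snd e = w} \<le> card {x \<in> Y. g x = w}"
      using finY by (simp add: card_image_le)
    then show ?thesis
      using True cap[OF True] by simp
  next
    case False
    with that obtain y where y: "w = item y"
      by auto
    have "{e \<in> ?F. fst e = w \<or> snd e = w} \<subseteq> {?e y}"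
      using gV False y by auto
    then have "card {e \<in> ?F. fst e = w \<or> snd e = w} \<le> card {?e y}"
      by (intro card_mono) auto
    then show ?thesis
      using False by (simp add: one_enat_def)
  qed
  have "feasible inst p ?F"
    unfolding feasible_def using edge budget capacities p0 by auto
  then have "(\<Sum>(u, v)\<in>?F. p u + p v) \<le> val inst p"
    by (rule revenue_le_val[OF lsp_instance_inst])
  also have "(\<Sum>(u, v)\<in>?F. p u + p v) = (\<Sum>x\<in>Y. p (g x))"
    by (subst sum.reindex) (auto simp: inj_on_def p0)
  finally show ?thesis .
qed

section \<open>Local optimality of the uniform price 1\<close>

lemma val_le_base:
  assumes p: "p \<in> pricings inst" and cS: "card {u \<in> V. p u \<noteq> 1} \<le> \<rho>"
  shows "val inst p \<le> real (C * card V)"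
proof (rule val_leI[OF lsp_instance_inst])
  fix F assume F: "feasible inst p F"
  define S where "S = {u \<in> V. p u \<noteq> 1}"
  have SV: "S \<subseteq> V" and finS: "finite S"
    using finV by (auto simp: S_def)
  have pS: "p u = high" if "u \<in> S" for u
    using that p price_set_subset[of u] by (auto simp: S_def pricings_def)
  have pN: "p u = 1" if "u \<in> V - S" for u
    using that by (auto simp: S_def)
  define T where "T = {x \<in> X. (fst x, item x) \<in> F}"
  define H where "H = {x \<in> arcs. (snd x, item x) \<in> F}"
  have F_sub: "F \<subseteq> tail_edges \<union> head_edges"
    and F_bud: "\<And>u v. (u, v) \<in> F \<Longrightarrow> p u + p v \<le> budget inst (u, v)"
    and F_cap: "\<And>w. w \<in> V \<union> item ` X \<Longrightarrow>
          enat (card {e \<in> F. fst e = w \<or> snd e = w}) \<le> capacity inst w"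
    using F by (auto simp: feasible_def)
  have finF: "finite F"
    using F_sub finX finite_subset by (fastforce simp: tail_edges_def head_edges_def)
  have finT: "finite T" and finH: "finite H"
    using finX by (auto simp: T_def H_def)
  have p0: "p (item x) = 0" for x
    using p item_notin_V by (auto simp: pricings_def)
  \<comment> \<open>Item capacity 1 forbids selling an arc at both ends.\<close>
  have disj: "T \<inter> H = {}"
  proof (rule ccontr)
    assume "T \<inter> H \<noteq> {}"
    then obtain x where x: "x \<in> T" "x \<in> H"
      by auto
    let ?E = "{e \<in> F. fst e = item x \<or> snd e = item x}"
    have "{(fst x, item x), (snd x, item x)} \<subseteq> ?E"
      using x by (auto simp: T_def H_def)
    then have "card {(fst x, item x), (snd x, item x)} \<le> card ?E"
      using finF by (intro card_mono) auto
    moreover have "card {(fst x, item x), (snd x, item x)} = 2"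
      using arc_ends_neq[of x] x by (auto simp: H_def)
    moreover have "card ?E \<le> 1"
      using F_cap[of "item x"] x item_notin_V[of x] by (auto simp: T_def one_enat_def)
    ultimately show False
      by linarith
  qed
  define f where "f v = card {e \<in> F. fst e = v}" for v
  have f_le: "f v \<le> card (H\<inverse> `` {v}) + card (T `` {v})" for v
  proof -
    have "{e \<in> F. fst e = v} \<subseteq>
        (\<lambda>w. (v, item (w, v))) ` (H\<inverse> `` {v}) \<union> (\<lambda>w. (v, item (v, w))) ` (T `` {v})"
    proof
      fix e assume e: "e \<in> {e \<in> F. fst e = v}"
      then have "e \<in> tail_edges \<or> e \<in> head_edges"
        using F_sub by auto
      then show "e \<in> (\<lambda>w. (v, item (w, v))) ` (H\<inverse> `` {v}) \<union> (\<lambda>w. (v, item (v, w))) ` (T `` {v})"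
      proof
        assume "e \<in> tail_edges"
        then obtain w where "e = (v, item (v, w))" "(v, w) \<in> X"
          using e by (auto simp: tail_edges_def)
        then show ?thesis
          using e by (auto simp: T_def)
      next
        assume "e \<in> head_edges"
        then obtain w where "e = (v, item (w, v))" "(w, v) \<in> arcs"
          using e by (auto simp: head_edges_def)
        then show ?thesis
          using e by (auto simp: H_def)
      qed
    qed
    then have "f v \<le> card ((\<lambda>w. (v, item (w, v))) ` (H\<inverse> `` {v}) \<union> (\<lambda>w. (v, item (v, w))) ` (T `` {v}))"
      unfolding f_def using finH finT by (intro card_mono) (auto simp: finite_Image)
    also have "\<dots> \<le> card ((\<lambda>w. (v, item (w, v))) ` (H\<inverse> `` {v})) + card ((\<lambda>w. (v, item (v, w))) ` (T `` {v}))"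
      by (rule card_Un_le)
    also have "\<dots> \<le> card (H\<inverse> `` {v}) + card (T `` {v})"
      using finH finT by (intro add_mono card_image_le) (auto simp: finite_Image)
    finally show ?thesis .
  qed
  have f_C: "f v \<le> C" if v: "v \<in> V" for v
  proof -
    have "f v \<le> card {e \<in> F. fst e = v \<or> snd e = v}"
      unfolding f_def using finF by (intro card_mono) auto
    then show ?thesis
      using F_cap[of v] v by simp
  qed
  \<comment> \<open>Of the \<open>C\<close> items leaving \<open>v\<close>, those in
    \<open>H\<close> are lost to \<open>v\<close>, and only incoming arcs of \<open>H\<close> can
    refill these slots. If they refill all of them, the truncated difference is 0 and the capacity
    bound suffices.\<close>
  have f_def_C: "f v + (card (H `` {v}) - card (H\<inverse> `` {v})) \<le> C" if v: "v \<in> V" for v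
  proof -
    have "card (T `` {v}) + card (H `` {v}) = card (T `` {v} \<union> H `` {v})"
      using disj finT finH by (intro card_Un_disjoint[symmetric]) (auto simp: finite_Image)
    also have "\<dots> \<le> card (X `` {v})"
      using finX by (intro card_mono) (auto simp: finite_Image T_def H_def)
    finally show ?thesis
      using f_le[of v] f_C[OF v] outdeg[OF v] by linarith
  qed
  \<comment> \<open>At price \<open>high\<close> the budget 1 of a tail edge is exceeded.\<close>
  have f_S: "f v \<le> card (H\<inverse> `` {v})" if v: "v \<in> S" for v
  proof -
    have "(v, w) \<notin> T" for w
    proof
      assume "(v, w) \<in> T"
      then have "(v, item (v, w)) \<in> F" "(v, item (v, w)) \<in> tail_edges"
        by (force simp: T_def tail_edges_def)+
      then show False
        using F_bud[of v "item (v, w)"] pS[OF v] p0 high_gt_1 by auto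
    qed
    then have "T `` {v} = {}"
      by auto
    then show ?thesis
      using f_le[of v] by simp
  qed
  define k where "k = card {x \<in> H. snd x \<in> S}"
  define D where "D = (\<Sum>v\<in>V - S. card (H `` {v}) - card (H\<inverse> `` {v}))"
  have k: "k = (\<Sum>v\<in>S. card (H\<inverse> `` {v}))"
    unfolding k_def by (rule card_arcs_by_head[OF finH finS])
  have kD: "k \<le> card S + D"
    unfolding k_def D_def
    by (rule card_arcs_into_le_deficit) (use SV cS in \<open>auto simp: S_def H_def\<close>)
  have "k \<le> (\<Sum>v\<in>S. C)"
    unfolding k
  proof (intro sum_mono)
    fix v assume "v \<in> S"
    have "card (H\<inverse> `` {v}) \<le> card (X\<inverse> `` {v})"
      using finX by (intro card_mono) (auto simp: finite_Image H_def)
    also have "\<dots> \<le> C"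
      using indeg \<open>v \<in> S\<close> SV by auto
    finally show "card (H\<inverse> `` {v}) \<le> C" .
  qed
  then have kC: "k \<le> C * card S"
    by (simp add: mult.commute)
  have fS: "(\<Sum>v\<in>S. f v) \<le> k"
    unfolding k by (intro sum_mono f_S)
  have "(\<Sum>v\<in>V - S. f v) + D \<le> (\<Sum>v\<in>V - S. C)"
    unfolding D_def sum.distrib[symmetric] by (intro sum_mono f_def_C) auto
  also have "\<dots> = C * card V - C * card S"
    using SV finS by (simp add: card_Diff_subset diff_mult_distrib mult.commute[of C])
  finally have "(\<Sum>v\<in>V - S. f v) + D \<le> C * card V - C * card S" .
  moreover have "C * card S \<le> C * card V"
    using card_mono[OF finV SV] by simp
  ultimately have fN: "(\<Sum>v\<in>V - S. f v) + D + C * card S \<le> C * card V"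
    by (simp only: le_diff_conv2)
  have F_V: "fst e \<in> V \<and> snd e \<in> range item" if "e \<in> F" for e
  proof -
    have "e \<in> tail_edges \<or> e \<in> head_edges"
      using that F_sub by blast
    then show ?thesis
      using tail_V by (auto simp: tail_edges_def head_edges_def)
  qed
  have "(\<Sum>(u, v)\<in>F. p u + p v) = (\<Sum>e\<in>F. p (fst e))"
    by (intro sum.cong) (use F_V p0 in fastforce)+
  also have "\<dots> = (\<Sum>v\<in>V. \<Sum>e\<in>{e \<in> F. fst e = v}. p (fst e))"
  proof (rule sum.group[symmetric, OF finF finV])
    show "fst ` F \<subseteq> V"
      using F_V by blast
  qed
  also have "\<dots> = (\<Sum>v\<in>V. p v * f v)"
    by (intro sum.cong) (auto simp: f_def)
  also have "\<dots> = (\<Sum>v\<in>V - S. p v * f v) + (\<Sum>v\<in>S. p v * f v)"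
    by (rule sum.subset_diff[OF SV finV])
  also have "\<dots> = real (\<Sum>v\<in>V - S. f v) + high * real (\<Sum>v\<in>S. f v)"
    by (simp add: pN pS sum_distrib_left)
  also have "\<dots> \<le> (real (C * card V) - real D - real (C * card S)) + high * real k"
  proof (intro add_mono mult_left_mono)
    show "real (\<Sum>v\<in>V - S. f v) \<le> real (C * card V) - real D - real (C * card S)"
      using fN by (simp only: of_nat_add[symmetric] of_nat_le_iff le_diff_eq)
  qed (use fS high_gt_1 in \<open>auto simp del: of_nat_sum\<close>)
  also have "\<dots> \<le> real (C * card V)"
  proof -
    \<comment> \<open>In \<open>high * k = k + (high - 1) * k\<close>, the first term is bounded by
      \<open>kD\<close> and the second by \<open>kC\<close>; the choice of \<open>high\<close> then
      makes all corrections cancel.\<close>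
    have "(high - 1) * real k \<le> (high - 1) * real (C * card S)"
      using kC high_gt_1 by (intro mult_left_mono) (simp_all only: of_nat_le_iff)
    also have "\<dots> = real (C * card S) - real (card S)"
      using C2 by (simp add: high_def field_simps)
    finally have "high * real k \<le> real k + real (C * card S) - real (card S)"
      by (simp add: algebra_simps)
    moreover have "real k \<le> real (card S) + real D"
      using kD by linarith
    ultimately show ?thesis
      by linarith
  qed
  finally show "(\<Sum>(u, v)\<in>F. p u + p v) \<le> real (C * card V)" .
qed

definition base :: "nat \<Rightarrow> real" where
  "base v = (if v \<in> V then 1 else 0)"

lemma base_pricing: "base \<in> pricings inst"
  using one_in_price_set by (auto simp: pricings_def base_def)

text \<open>The upper bound is the case of no switched vertex. For the lower bound every item goes
  to its tail, and padding makes the number of items exactly \<open>C * card V\<close>.\<close>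

lemma val_base: "val inst base = real (C * card V)"
proof (rule antisym)
  have "{u \<in> V. base u \<noteq> 1} = {}"
    by (auto simp: base_def)
  then have "card {u \<in> V. base u \<noteq> 1} \<le> \<rho>"
    by (simp only: card.empty)
  then show "val inst base \<le> real (C * card V)"
    by (rule val_le_base[OF base_pricing])
  have deg: "card {x \<in> X. fst x = w} = C" if "w \<in> V" for w
    using card_arcs_by_tail[OF finX, of "{w}"] outdeg[OF that] by simp
  have "{x \<in> X. fst x \<in> V} = X"
    using tail_V by auto
  then have "card X = (\<Sum>u\<in>V. C)"
    using card_arcs_by_tail[OF finX finV] outdeg by simp
  then have "real (C * card V) = (\<Sum>x\<in>X. base (fst x))"
    using tail_V by (simp add: base_def mult.commute)
  also have "\<dots> \<le> val inst base"
    by (rule assignment_le_val[OF base_pricing])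
      (use tail_V deg in \<open>auto simp: tail_edges_def base_def\<close>)
  finally show "real (C * card V) \<le> val inst base" .
qed

lemma base_local_optimum: "base \<in> local_optima inst \<rho>"
proof -
  have "val inst p \<le> val inst base"
    if "p \<in> pricings inst" "card {u \<in> V. p u \<noteq> base u} \<le> \<rho>" for p
  proof -
    have "{u \<in> V. p u \<noteq> base u} = {u \<in> V. p u \<noteq> 1}"
      by (auto simp: base_def)
    then show ?thesis
      using that val_le_base[of p] by (simp add: val_base)
  qed
  then show ?thesis
    by (simp add: local_optima_def base_pricing)
qed

text \<open>Every arc is sold to its head at price \<open>high\<close>. Vertices without incoming
  arcs do not have \<open>high\<close> in their price set and stay at 1.\<close>

lemma opt_val_ge: "high * real (card arcs) \<le> opt_val inst"
proof -
  define p where "p v = (if v \<in> snd ` arcs then high else if v \<in> V then 1 else 0)" for v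
  have p: "p \<in> pricings inst"
    using one_in_price_set high_in_price_set
    by (auto simp: pricings_def p_def simp del: Int_iff)
  have deg: "card {x \<in> arcs. snd x = w} \<le> C" if "w \<in> V" for w
  proof -
    have "card {x \<in> arcs. snd x = w} \<le> card {x \<in> X. snd x = w}"
      using finX by (intro card_mono) auto
    also have "\<dots> = card (X\<inverse> `` {w})"
      using card_arcs_by_head[OF finX, of "{w}"] by simp
    finally show ?thesis
      using indeg[OF that] by simp
  qed
  have ph: "p (snd x) = high" if "x \<in> arcs" for x
    using that by (auto simp: p_def)
  have he: "(snd x, item x) \<in> head_edges" if "x \<in> arcs" for x
    using that by (auto simp: head_edges_def)
  have "high * real (card arcs) = (\<Sum>x\<in>arcs. p (snd x))"
    by (simp add: ph)
  also have "\<dots> \<le> val inst p"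
    by (rule assignment_le_val[OF p]) (use ph he head_edges_not_tail deg in auto)
  also have "\<dots> \<le> opt_val inst"
    by (rule val_le_opt_val[OF lsp_instance_inst p])
  finally show ?thesis .
qed

lemma locality_gap_ge:
  assumes "V \<noteq> {}"
  shows "ereal (high * real (card arcs) / real (C * card V)) \<le> locality_gap inst \<rho>"
proof -
  have pos: "real (C * card V) > 0"
    using assms finV C2 by (simp add: card_gt_0_iff)
  have "ereal (high * real (card arcs) / real (C * card V))
      \<le> ereal (opt_val inst / real (C * card V))"
    using opt_val_ge pos by (simp add: divide_right_mono)
  also have "\<dots> = ereal (opt_val inst) / ereal (val inst base)"
    unfolding val_base using pos by (metis ereal_divide less_irrefl)
  also have "\<dots> \<le> locality_gap inst \<rho>"
    by (rule ratio_le_locality_gap[OF lsp_instance_inst base_local_optimum])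
  finally show ?thesis .
qed

end

section \<open>Padding the digraph and choosing parameters\<close>

text \<open>Dummy heads are numbered from \<open>m\<close> on, so padding changes neither the
  in-degrees of real vertices nor the arcs among them.\<close>

lemma exists_pricing_graph:
  fixes C N \<rho> n :: nat
  assumes "C \<ge> 2" and "\<rho> \<ge> 1" and "n \<ge> 1"
  defines "m \<equiv> Suc N * n"
  defines "K \<equiv> \<rho> + \<rho> * C * Suc N"
  shows "\<exists>X. pricing_graph {..<m} X (\<lambda>v. v div n) C N \<rho> \<and>
           N * (C * (n - (\<Sum>i\<le>2 * K. (2 * C) ^ i))) \<le> card (X \<inter> {..<m} \<times> {..<m})"
proof -
  have "K \<ge> 1"
    using assms by (simp add: K_def)
  then obtain G where sub: "G \<subseteq> {..<m} \<times> {..<m}"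
    and lay: "\<And>u v. (u, v) \<in> G \<Longrightarrow> v div n = Suc (u div n)"
    and out: "\<And>u. card (G `` {u}) \<le> C" and inn: "\<And>v. card (G\<inverse> `` {v}) \<le> C"
    and sp: "locally_sparse K G"
    and many: "N * (C * (n - (\<Sum>i\<le>2 * K. (2 * C) ^ i))) \<le> card G"
    unfolding m_def using exists_sparse_layered_graph[OF _ \<open>n \<ge> 1\<close>] by metis
  have fin: "finite G"
    using sub by (rule finite_subset) auto
  define X where "X = G \<union> (SIGMA u:{..<m}. {m..<m + (C - card (G `` {u}))})"
  have XG: "X \<inter> {..<m} \<times> {..<m} = G"
    using sub by (auto simp: X_def)
  have "pricing_graph {..<m} X (\<lambda>v. v div n) C N \<rho>"
  proof
    show "finite X"
      by (auto simp: X_def fin)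
    show "fst x \<in> {..<m}" if "x \<in> X" for x
      using that sub by (auto simp: X_def)
    show "card (X `` {u}) = C" if "u \<in> {..<m}" for u
    proof -
      have "X `` {u} = G `` {u} \<union> {m..<m + (C - card (G `` {u}))}"
        using that by (auto simp: X_def)
      moreover have "card (G `` {u} \<union> {m..<m + (C - card (G `` {u}))})
          = card (G `` {u}) + card {m..<m + (C - card (G `` {u}))}"
        using sub fin by (intro card_Un_disjoint) (auto simp: finite_Image)
      ultimately show ?thesis
        using out[of u] by simp
    qed
    show "card (X\<inverse> `` {v}) \<le> C" if "v \<in> {..<m}" for v
    proof -
      have "X\<inverse> `` {v} = G\<inverse> `` {v}"
        using that by (auto simp: X_def)
      then show ?thesis
        using inn by simp
    qed
    show "v div n = Suc (u div n)" if "(u, v) \<in> X" "v \<in> {..<m}" for u v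
      using that lay by (auto simp: X_def)
    show "v div n \<le> N" if "v \<in> {..<m}" for v
      using that less_mult_imp_div_less[of v "Suc N" n] by (simp add: m_def)
    show "locally_sparse (\<rho> + \<rho> * C * Suc N) (X \<inter> {..<m} \<times> {..<m})"
      using sp XG by (simp add: K_def)
  qed (use assms in auto)
  then show ?thesis
    using many XG by auto
qed

theorem theorem12:
  fixes C \<rho> :: nat and \<epsilon> :: real
  assumes "C \<ge> 2" and "\<rho> \<ge> 1" and "\<epsilon> > 0"
  shows "\<exists>I :: nat lsp_instance.
           lsp_instance I \<and>
           (\<forall>u\<in>left I. capacity I u = enat C) \<and>
           (\<forall>v\<in>right I. capacity I v = 1) \<and>
           locality_gap I \<rho> \<ge> ereal ((2 * real C - 1) / real C - \<epsilon>)"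
proof -
  \<comment> \<open>The source layer costs at most \<open>2 / (N + 1)\<close>, which gets half of
    \<open>\<epsilon>\<close>. \<open>N\<close> comes first because \<open>T\<close> depends on
    it.\<close>
  obtain N :: nat where N: "4 / \<epsilon> < real N"
    using reals_Archimedean2 by blast
  define T where "T = (\<Sum>i\<le>2 * (\<rho> + \<rho> * C * Suc N). (2 * C) ^ i)"
  obtain n0 :: nat where n0: "4 * real T / \<epsilon> < real n0"
    using reals_Archimedean2 by blast
  \<comment> \<open>Exceeding \<open>n0\<close> makes the share \<open>T / n\<close> of unfilled
    heads cost at most the other half of \<open>\<epsilon>\<close>; exceeding \<open>T\<close> keeps
    \<open>n - T\<close> untruncated.\<close>
  define n where "n = Suc (n0 + T)"
  let ?m = "Suc N * n"
  obtain X where X: "pricing_graph {..<?m} X (\<lambda>v. v div n) C N \<rho>"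
    and many: "N * (C * (n - T)) \<le> card (X \<inter> {..<?m} \<times> {..<?m})"
    using exists_pricing_graph[OF assms(1,2), of n N] unfolding T_def n_def by auto
  interpret pricing_graph "{..<?m}" X "\<lambda>v. v div n" C N \<rho>
    by (rule X)
  have high_le: "high \<le> 2"
    using assms(1) by (simp add: high_def field_simps)
  have N1: "2 / (real N + 1) \<le> \<epsilon> / 2"
  proof -
    have "4 \<le> \<epsilon> * (real N + 1)"
      using N assms(3) by (simp add: field_simps)
    then show ?thesis
      by (simp add: field_simps)
  qed
  have T1: "2 * (real T / real n) \<le> \<epsilon> / 2"
  proof -
    have "4 * real T \<le> \<epsilon> * real n0"
      using n0 assms(3) by (simp add: field_simps)
    also have "\<dots> \<le> \<epsilon> * real n"
      using assms(3) by (simp add: n_def)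
    finally show ?thesis
      by (simp add: field_simps n_def)
  qed
  \<comment> \<open>\<open>a\<close> is the share of layers other than the source, \<open>b\<close>
    the guaranteed share of filled incoming slots in such a layer.\<close>
  define a where "a = real N / (real N + 1)"
  define b where "b = 1 - real T / real n"
  have ab: "a \<le> 1" "0 \<le> real T / real n"
    by (auto simp: a_def)
  have a1: "1 - a = 1 / (real N + 1)"
    by (simp add: a_def field_simps)
  have "high - high * (a * b) = high * ((1 - a) + a * (real T / real n))"
    by (simp add: b_def algebra_simps)
  also have "\<dots> \<le> 2 * ((1 - a) + 1 * (real T / real n))"
    using high_le ab by (intro mult_mono add_mono mult_right_mono) (auto simp: a_def)
  also have "\<dots> \<le> \<epsilon>"
    using N1 T1 by (simp add: a1)
  finally have "high - \<epsilon> \<le> high * (a * b)"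
    by linarith
  also have "\<dots> = high * (real (N * (C * (n - T))) / real (C * card {..<?m}))"
  proof -
    have "b = real (n - T) / real n"
      by (simp add: b_def n_def of_nat_diff field_simps)
    moreover have "real (N * (C * (n - T))) / real (C * card {..<?m})
        = (real C * (real N * real (n - T))) / (real C * ((real N + 1) * real n))"
      by (simp add: distrib_right)
    ultimately show ?thesis
      using assms(1) by (simp add: a_def del: of_nat_mult)
  qed
  also have "\<dots> \<le> high * (real (card (X \<inter> {..<?m} \<times> {..<?m})) / real (C * card {..<?m}))"
    using many high_gt_1 by (intro mult_left_mono divide_right_mono) (auto simp only: of_nat_le_iff)
  finally have "ereal (high - \<epsilon>)
      \<le> ereal (high * real (card (X \<inter> {..<?m} \<times> {..<?m})) / real (C * card {..<?m}))"
    by simp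
  also have "\<dots> \<le> locality_gap inst \<rho>"
    by (rule locality_gap_ge) (auto simp: n_def)
  finally have "ereal ((2 * real C - 1) / real C - \<epsilon>) \<le> locality_gap inst \<rho>"
    by (simp add: high_def)
  then show ?thesis
    using lsp_instance_inst capacity_left capacity_right by blast
qed

end
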